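(* The five axioms (A1)–(A5) for a skew monoidal category are independent: for each $k\in\{1,2,3,4,5\}$ there exist skew monoidal data $(\mathcal{C},\otimes,I,\alpha,\lambda,\rho)$ for which axiom (A$k$) fails but the other four of the axioms (A1)–(A5) hold.
   Context: Skew monoidal data $(\mathcal{C},\otimes,I,\alpha,\lambda,\rho)$ consist of a category $\mathcal{C}$, a functor $\otimes:\mathcal{C}\times\mathcal{C}\to\mathcal{C}$, an object $I$ of $\mathcal{C}$, and natural transformations (not assumed invertible) with components $\alpha_{X,Y,Z}:(X\otimes Y)\otimes Z\to X\otimes(Y\otimes Z)$, $\lambda_X:I\otimes X\to X$, $\rho_X:X\to X\otimes I$. A skew monoidal category is such data satisfying the following five axioms for all objects $W,X,Y,Z$: - (A1) $\alpha_{W,X,Y\otimes Z}\circ\alpha_{W\otimes X,Y,Z}=(1_W\otimes\alpha_{X,Y,Z})\circ\alpha_{W,X\otimes Y,Z}\circ(\alpha_{W,X,Y}\otimes 1_Z)$; - (A2) $\lambda_{X\otimes Y}\circ\alpha_{I,X,Y}=\lambda_X\otimes 1_Y$; - (A3) $(1_X\otimes\lambda_Y)\circ\alpha_{X,I,Y}\circ(\rho_X\otimes 1_Y)=1_{X\otimes Y}$; - (A4) $\alpha_{X,Y,I}\circ\rho_{X\otimes Y}=1_X\otimes\rho_Y$; - (A5) $\lambda_I\circ\rho_I=1_I$. *)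

theory Defs
  imports Main
begin

section \<open>Categories, functors, natural transformations\<close>

text \<open>
  The components of these records are total functions on the underlying types; only their values
  on objects in \<open>Ob\<close>, arrows in \<open>Ar\<close> and composable pairs are relevant. Composition is written
  in applicative order: \<open>g \<cdot> f\<close> is \<open>g\<close> after \<open>f\<close>.
\<close>

record ('o, 'a) cat =
  Ob :: "'o set"
  Ar :: "'a set"
  Dom :: "'a \<Rightarrow> 'o"
  Cod :: "'a \<Rightarrow> 'o"
  Id :: "'o \<Rightarrow> 'a"
  Comp :: "'a \<Rightarrow> 'a \<Rightarrow> 'a"  (infixr "\<cdot>\<index>" 55)

definition Hom :: "('o, 'a, 'm) cat_scheme \<Rightarrow> 'o \<Rightarrow> 'o \<Rightarrow> 'a set" where
  "Hom C X Y = {f \<in> Ar C. Dom C f = X \<and> Cod C f = Y}"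

locale category =
  fixes C :: "('o, 'a, 'm) cat_scheme" (structure)
  assumes Dom_in_Ob: "f \<in> Ar C \<Longrightarrow> Dom C f \<in> Ob C"
    and Cod_in_Ob: "f \<in> Ar C \<Longrightarrow> Cod C f \<in> Ob C"
    and Id_in_Hom: "X \<in> Ob C \<Longrightarrow> Id C X \<in> Hom C X X"
    and Comp_in_Hom: "\<lbrakk>f \<in> Hom C X Y; g \<in> Hom C Y Z\<rbrakk> \<Longrightarrow> g \<cdot> f \<in> Hom C X Z"
    and Comp_Id: "f \<in> Hom C X Y \<Longrightarrow> f \<cdot> Id C X = f"
    and Id_Comp: "f \<in> Hom C X Y \<Longrightarrow> Id C Y \<cdot> f = f"
    and Comp_assoc: "\<lbrakk>f \<in> Hom C W X; g \<in> Hom C X Y; h \<in> Hom C Y Z\<rbrakk>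
      \<Longrightarrow> (h \<cdot> g) \<cdot> f = h \<cdot> (g \<cdot> f)"

definition prod_cat ::
  "('o, 'a, 'm) cat_scheme \<Rightarrow> ('p, 'b, 'n) cat_scheme \<Rightarrow> ('o \<times> 'p, 'a \<times> 'b) cat" where
  "prod_cat C D =
    \<lparr>Ob = Ob C \<times> Ob D,
     Ar = Ar C \<times> Ar D,
     Dom = (\<lambda>(f, g). (Dom C f, Dom D g)),
     Cod = (\<lambda>(f, g). (Cod C f, Cod D g)),
     Id = (\<lambda>(X, Y). (Id C X, Id D Y)),
     Comp = (\<lambda>(f', g') (f, g). (Comp C f' f, Comp D g' g))\<rparr>"

locale is_functor =
  source: category C + target: category D
  for C :: "('o, 'a, 'm) cat_scheme"
    and D :: "('p, 'b, 'n) cat_scheme"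
    and Fo :: "'o \<Rightarrow> 'p"
    and Fa :: "'a \<Rightarrow> 'b" +
  assumes Ob_map: "X \<in> Ob C \<Longrightarrow> Fo X \<in> Ob D"
    and Hom_map: "f \<in> Hom C X Y \<Longrightarrow> Fa f \<in> Hom D (Fo X) (Fo Y)"
    and Id_map: "X \<in> Ob C \<Longrightarrow> Fa (Id C X) = Id D (Fo X)"
    and Comp_map: "\<lbrakk>f \<in> Hom C X Y; g \<in> Hom C Y Z\<rbrakk>
      \<Longrightarrow> Fa (Comp C g f) = Comp D (Fa g) (Fa f)"

locale natural_transformation =
  F: is_functor C D Fo Fa + G: is_functor C D Go Ga
  for C :: "('o, 'a, 'm) cat_scheme"
    and D :: "('p, 'b, 'n) cat_scheme"
    and Fo :: "'o \<Rightarrow> 'p" and Fa :: "'a \<Rightarrow> 'b"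
    and Go :: "'o \<Rightarrow> 'p" and Ga :: "'a \<Rightarrow> 'b"
    and \<tau> :: "'o \<Rightarrow> 'b" +
  assumes component_in_Hom: "X \<in> Ob C \<Longrightarrow> \<tau> X \<in> Hom D (Fo X) (Go X)"
    and naturality: "f \<in> Hom C X Y \<Longrightarrow> Comp D (\<tau> Y) (Fa f) = Comp D (Ga f) (\<tau> X)"


section \<open>Skew monoidal data and the five axioms\<close>

text \<open>\<open>X \<otimes> Y\<close> is the tensor of objects, \<open>f \<boxtimes> g\<close> the tensor of arrows.\<close>

record ('o, 'a) skew_data = "('o, 'a) cat" +
  tensor_ob :: "'o \<Rightarrow> 'o \<Rightarrow> 'o"  (infixl "\<otimes>\<index>" 70)
  tensor_ar :: "'a \<Rightarrow> 'a \<Rightarrow> 'a"  (infixl "\<boxtimes>\<index>" 70)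
  tensor_unit :: 'o
  associator :: "'o \<Rightarrow> 'o \<Rightarrow> 'o \<Rightarrow> 'a"
  left_unitor :: "'o \<Rightarrow> 'a"
  right_unitor :: "'o \<Rightarrow> 'a"

text \<open>Triples are nested pairs, so the associator lives over \<open>prod_cat D (prod_cat D D)\<close>.\<close>

locale skew_monoidal_data =
  category D +
  tensor: is_functor "prod_cat D D" D
    "\<lambda>(X, Y). X \<otimes> Y" "\<lambda>(f, g). f \<boxtimes> g" +
  associator: natural_transformation "prod_cat D (prod_cat D D)" D
    "\<lambda>(X, Y, Z). (X \<otimes> Y) \<otimes> Z" "\<lambda>(f, g, h). (f \<boxtimes> g) \<boxtimes> h"
    "\<lambda>(X, Y, Z). X \<otimes> (Y \<otimes> Z)" "\<lambda>(f, g, h). f \<boxtimes> (g \<boxtimes> h)"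
    "\<lambda>(X, Y, Z). associator D X Y Z" +
  left_unitor: natural_transformation D D
    "\<lambda>X. tensor_unit D \<otimes> X" "\<lambda>f. Id D (tensor_unit D) \<boxtimes> f"
    "\<lambda>X. X" "\<lambda>f. f"
    "left_unitor D" +
  right_unitor: natural_transformation D D
    "\<lambda>X. X" "\<lambda>f. f"
    "\<lambda>X. X \<otimes> tensor_unit D" "\<lambda>f. f \<boxtimes> Id D (tensor_unit D)"
    "right_unitor D"
  for D :: "('o, 'a, 'm) skew_data_scheme" (structure) +
  assumes tensor_unit_in_Ob: "tensor_unit D \<in> Ob D"

context
  fixes D :: "('o, 'a, 'm) skew_data_scheme" (structure)
begin

definition axiom_A1 :: bool where
  "axiom_A1 \<longleftrightarrow> (\<forall>W\<in>Ob D. \<forall>X\<in>Ob D. \<forall>Y\<in>Ob D. \<forall>Z\<in>Ob D.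
    associator D W X (Y \<otimes> Z) \<cdot> associator D (W \<otimes> X) Y Z =
    (Id D W \<boxtimes> associator D X Y Z) \<cdot> associator D W (X \<otimes> Y) Z
      \<cdot> (associator D W X Y \<boxtimes> Id D Z))"

definition axiom_A2 :: bool where
  "axiom_A2 \<longleftrightarrow> (\<forall>X\<in>Ob D. \<forall>Y\<in>Ob D.
    left_unitor D (X \<otimes> Y) \<cdot> associator D (tensor_unit D) X Y = left_unitor D X \<boxtimes> Id D Y)"

definition axiom_A3 :: bool where
  "axiom_A3 \<longleftrightarrow> (\<forall>X\<in>Ob D. \<forall>Y\<in>Ob D.
    (Id D X \<boxtimes> left_unitor D Y) \<cdot> associator D X (tensor_unit D) Y
      \<cdot> (right_unitor D X \<boxtimes> Id D Y) = Id D (X \<otimes> Y))"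

definition axiom_A4 :: bool where
  "axiom_A4 \<longleftrightarrow> (\<forall>X\<in>Ob D. \<forall>Y\<in>Ob D.
    associator D X Y (tensor_unit D) \<cdot> right_unitor D (X \<otimes> Y) = Id D X \<boxtimes> right_unitor D Y)"

definition axiom_A5 :: bool where
  "axiom_A5 \<longleftrightarrow>
    left_unitor D (tensor_unit D) \<cdot> right_unitor D (tensor_unit D) = Id D (tensor_unit D)"

end

text \<open>Axiom (A\<open>k\<close>); only meaningful for \<open>k \<in> {1..5}\<close>.\<close>

definition skew_axiom :: "nat \<Rightarrow> ('o, 'a, 'm) skew_data_scheme \<Rightarrow> bool" where
  "skew_axiom k D \<longleftrightarrow>
    (k = 1 \<longrightarrow> axiom_A1 D) \<and> (k = 2 \<longrightarrow> axiom_A2 D) \<and> (k = 3 \<longrightarrow> axiom_A3 D) \<and>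
    (k = 4 \<longrightarrow> axiom_A4 D) \<and> (k = 5 \<longrightarrow> axiom_A5 D)"

end

theory Submission
  imports Defs
begin

text \<open>
  All five countermodels live on one category: its objects are the natural numbers, and every
  object has the same endomorphism monoid, the truth values under conjunction, with no arrows
  between distinct objects. Objects are tensored by addition, with unit \<open>0\<close>. Since source and
  target of each structure map then coincide as objects, \<open>\<alpha>\<close> may be any family of truth values
  \<open>a x y z\<close>: the endomorphism monoid is commutative, so naturality imposes nothing on it.

  With \<open>\<lambda>\<close> the identity and arrows tensored by conjunction, naturality still allows \<open>\<rho>\<close> to be the
  identity, and (A2), (A3) and (A4) restrict \<open>a\<close> at triples having \<open>0\<close> in one prescribed position
  only: the first, the second and the third, respectively. Each of these is violated
  alone by a family \<open>a\<close> depending only on which arguments are \<open>0\<close>; falsity being absorbing, it can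
  be placed so that both sides of the pentagon (A1) are false together. For (A1) itself, a single
  false value at the triple \<open>(1, 1, 1)\<close> is invisible to the unit axioms, but occurs on one side
  only of the pentagon at \<open>(1, 1, 1, 1)\<close>.

  In that setting (A5) cannot be violated, because the other axioms force \<open>\<rho>\<close> at the unit to be
  the identity. The tensor of arrows is therefore made to forget its first factor: if it is the
  second projection on truth values, naturality leaves falsity as a choice for \<open>\<rho>\<close>. This
  choice is harmless in (A3), where the tensor forgets \<open>\<rho>\<close>, and in (A4), where both sides are
  false, while (A5) fails.

  A truth value \<open>r\<close>, which is the component of \<open>\<rho>\<close>, switches between the two tensors of arrows.
  The lemma \<open>labelled_skew_data\<close> shows that \<open>r\<close> and \<open>a\<close> are unrestricted, and the lemmas after it
  turn the axioms into conditions on them.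
\<close>

section \<open>Arrows labelled by truth values\<close>

text \<open>
  An arrow is a pair of an object and a label. Coding the label as the parity makes every number
  the code of exactly one arrow, so that no number has to be excluded from objects or arrows.
\<close>

definition labelled_arr :: "nat \<Rightarrow> bool \<Rightarrow> nat" where
  "labelled_arr x b = 2 * x + of_bool b"

abbreviation base :: "nat \<Rightarrow> nat" where
  "base f \<equiv> f div 2"

abbreviation label :: "nat \<Rightarrow> bool" where
  "label f \<equiv> odd f"

lemma base_labelled_arr [simp]: "base (labelled_arr x b) = x"
  by (simp add: labelled_arr_def)

lemma label_labelled_arr [simp]: "label (labelled_arr x b) = b"
  by (simp add: labelled_arr_def)

lemma labelled_arr_base_label [simp]: "labelled_arr (base f) (label f) = f"
  by (simp add: labelled_arr_def mod2_eq_if[symmetric] of_bool_odd_eq_mod_2)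

lemma labelled_arr_eq_iff [simp]:
  "labelled_arr x b = labelled_arr y c \<longleftrightarrow> x = y \<and> b = c"
  by (cases b; cases c) (simp_all add: labelled_arr_def, presburger+)

text \<open>
  The tensor of labels is conjunction if \<open>r\<close> holds and the second projection otherwise.
\<close>

definition labelled_data :: "bool \<Rightarrow> (nat \<Rightarrow> nat \<Rightarrow> nat \<Rightarrow> bool) \<Rightarrow> (nat, nat) skew_data" where
  "labelled_data r a =
    \<lparr>Ob = UNIV, Ar = UNIV, Dom = base, Cod = base,
     Id = (\<lambda>x. labelled_arr x True),
     Comp = (\<lambda>g f. labelled_arr (base f) (label g \<and> label f)),
     tensor_ob = (+),
     tensor_ar = (\<lambda>f g. labelled_arr (base f + base g) ((r \<longrightarrow> label f) \<and> label g)),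
     tensor_unit = 0,
     associator = (\<lambda>x y z. labelled_arr (x + y + z) (a x y z)),
     left_unitor = (\<lambda>x. labelled_arr x True),
     right_unitor = (\<lambda>x. labelled_arr x r)\<rparr>"

lemma Hom_prod_cat:
  "Hom (prod_cat C D) X Y = Hom C (fst X) (fst Y) \<times> Hom D (snd X) (snd Y)"
  by (auto simp: Hom_def prod_cat_def)

lemma category_prod_cat:
  assumes "category C" and "category D"
  shows "category (prod_cat C D)"
proof -
  interpret C: category C by fact
  interpret D: category D by fact
  show ?thesis
  proof (unfold_locales, unfold Hom_prod_cat)
  qed (auto simp: prod_cat_def
      intro: C.Dom_in_Ob C.Cod_in_Ob D.Dom_in_Ob D.Cod_in_Ob C.Id_in_Hom D.Id_in_Hom
        C.Comp_in_Hom D.Comp_in_Hom C.Comp_Id D.Comp_Id C.Id_Comp D.Id_Comp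
        C.Comp_assoc D.Comp_assoc)
qed

lemma category_labelled_data: "category (labelled_data r a)"
  by unfold_locales (auto simp: labelled_data_def Hom_def)

text \<open>
  The switch \<open>r\<close> is tied to \<open>\<rho>\<close> by naturality of \<open>\<rho>\<close>, which requires
  \<open>r \<and> p \<longleftrightarrow> (r \<longrightarrow> p) \<and> r\<close> for all labels \<open>p\<close>. The tensor of labels is associative in both cases,
  so that the naturality squares of \<open>\<alpha>\<close> commute for every \<open>a\<close>.
\<close>

lemma labelled_skew_data: "skew_monoidal_data (labelled_data r a)"
proof -
  let ?D = "labelled_data r a"
  have D: "category ?D"
    by (rule category_labelled_data)
  note DD = category_prod_cat[OF D D]
  note DDD = category_prod_cat[OF D DD]
  show ?thesis
    unfolding skew_monoidal_data_def skew_monoidal_data_axioms_def natural_transformation_def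
      natural_transformation_axioms_def is_functor_def is_functor_axioms_def
    using D DD DDD
    by (auto simp: labelled_data_def prod_cat_def Hom_def)
qed


section \<open>The axioms as conditions on labels\<close>

lemma labelled_axiom_A1:
  "axiom_A1 (labelled_data r a) \<longleftrightarrow>
    (\<forall>w x y z. a w x (y + z) \<and> a (w + x) y z \<longleftrightarrow>
      a x y z \<and> a w (x + y) z \<and> (r \<longrightarrow> a w x y))"
  by (simp add: axiom_A1_def labelled_data_def add.assoc)

lemma labelled_axiom_A2: "axiom_A2 (labelled_data r a) \<longleftrightarrow> (\<forall>x y. a 0 x y)"
  by (simp add: axiom_A2_def labelled_data_def)

text \<open>
  The component of \<open>\<rho>\<close> drops out here: \<open>\<rho> \<otimes> 1\<close> has label \<open>r \<longrightarrow> r\<close>.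
\<close>

lemma labelled_axiom_A3: "axiom_A3 (labelled_data r a) \<longleftrightarrow> (\<forall>x y. a x 0 y)"
  by (simp add: axiom_A3_def labelled_data_def)

lemma labelled_axiom_A4: "axiom_A4 (labelled_data r a) \<longleftrightarrow> (r \<longrightarrow> (\<forall>x y. a x y 0))"
  by (auto simp: axiom_A4_def labelled_data_def)

lemma labelled_axiom_A5: "axiom_A5 (labelled_data r a) \<longleftrightarrow> r"
  by (simp add: axiom_A5_def labelled_data_def)

lemmas labelled_axioms =
  labelled_axiom_A1 labelled_axiom_A2 labelled_axiom_A3 labelled_axiom_A4 labelled_axiom_A5


section \<open>The five countermodels\<close>

lemma only_A1_fails:
  "\<exists>D :: (nat, nat) skew_data. skew_monoidal_data D \<and>
    \<not> axiom_A1 D \<and> axiom_A2 D \<and> axiom_A3 D \<and> axiom_A4 D \<and> axiom_A5 D"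
proof -
  let ?a = "\<lambda>(x::nat) (y::nat) (z::nat). \<not> (x = 1 \<and> y = 1 \<and> z = 1)"
  let ?D = "labelled_data True ?a"
  \<comment> \<open>At \<open>(1, 1, 1, 1)\<close> one side of the pentagon only has the triples \<open>(1, 1, 2)\<close> and
    \<open>(2, 1, 1)\<close>, while \<open>(1, 1, 1)\<close> is on the other side.\<close>
  have "\<not> (?a 1 1 (1 + 1) \<and> ?a (1 + 1) 1 1 \<longleftrightarrow>
      ?a 1 1 1 \<and> ?a 1 (1 + 1) 1 \<and> (True \<longrightarrow> ?a 1 1 1))"
    by simp
  then have "\<not> axiom_A1 ?D"
    unfolding labelled_axiom_A1 by blast
  moreover have "axiom_A2 ?D \<and> axiom_A3 ?D \<and> axiom_A4 ?D \<and> axiom_A5 ?D"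
    by (simp add: labelled_axioms)
  ultimately show ?thesis
    using labelled_skew_data by blast
qed

text \<open>
  The pentagon commutes because either of its sides at \<open>(w, x, y, z)\<close> is false exactly if at least
  two of \<open>x\<close>, \<open>y\<close> and \<open>z\<close> are nonzero.
\<close>

lemma only_A2_fails:
  "\<exists>D :: (nat, nat) skew_data. skew_monoidal_data D \<and>
    axiom_A1 D \<and> \<not> axiom_A2 D \<and> axiom_A3 D \<and> axiom_A4 D \<and> axiom_A5 D"
  by (rule exI[of _ "labelled_data True (\<lambda>x y z. \<not> (y \<noteq> 0 \<and> z \<noteq> 0))"])
    (auto simp: labelled_skew_data labelled_axioms)

text \<open>
  The pentagon commutes because either of its sides at \<open>(w, x, y, z)\<close> is false exactly if one of
  the inner entries \<open>x\<close> and \<open>y\<close> is zero and has nonzero entries somewhere to its left and somewhere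
  to its right.
\<close>

lemma only_A3_fails:
  "\<exists>D :: (nat, nat) skew_data. skew_monoidal_data D \<and>
    axiom_A1 D \<and> axiom_A2 D \<and> \<not> axiom_A3 D \<and> axiom_A4 D \<and> axiom_A5 D"
  by (rule exI[of _ "labelled_data True (\<lambda>x y z. \<not> (x \<noteq> 0 \<and> y = 0 \<and> z \<noteq> 0))"])
    (auto simp: labelled_skew_data labelled_axioms)

text \<open>
  The mirror image of the model for (A2).
\<close>

lemma only_A4_fails:
  "\<exists>D :: (nat, nat) skew_data. skew_monoidal_data D \<and>
    axiom_A1 D \<and> axiom_A2 D \<and> axiom_A3 D \<and> \<not> axiom_A4 D \<and> axiom_A5 D"
  by (rule exI[of _ "labelled_data True (\<lambda>x y z. \<not> (x \<noteq> 0 \<and> y \<noteq> 0))"])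
    (auto simp: labelled_skew_data labelled_axioms)

lemma only_A5_fails:
  "\<exists>D :: (nat, nat) skew_data. skew_monoidal_data D \<and>
    axiom_A1 D \<and> axiom_A2 D \<and> axiom_A3 D \<and> axiom_A4 D \<and> \<not> axiom_A5 D"
  by (rule exI[of _ "labelled_data False (\<lambda>x y z. True)"])
    (auto simp: labelled_skew_data labelled_axioms)

theorem proposition2p14:
  shows "\<forall>k\<in>{1..5::nat}. \<exists>D :: (nat, nat) skew_data.
    skew_monoidal_data D \<and> \<not> skew_axiom k D \<and> (\<forall>j\<in>{1..5} - {k}. skew_axiom j D)"
proof
  fix k :: nat
  assume "k \<in> {1..5}"
  then consider "k = 1" | "k = 2" | "k = 3" | "k = 4" | "k = 5"
    by fastforce
  then show "\<exists>D :: (nat, nat) skew_data.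
    skew_monoidal_data D \<and> \<not> skew_axiom k D \<and> (\<forall>j\<in>{1..5} - {k}. skew_axiom j D)"
  proof cases
    case 1
    then show ?thesis
      by - (rule ex_forward[OF only_A1_fails], simp add: skew_axiom_def)
  next
    case 2
    then show ?thesis
      by - (rule ex_forward[OF only_A2_fails], simp add: skew_axiom_def)
  next
    case 3
    then show ?thesis
      by - (rule ex_forward[OF only_A3_fails], simp add: skew_axiom_def)
  next
    case 4
    then show ?thesis
      by - (rule ex_forward[OF only_A4_fails], simp add: skew_axiom_def)
  next
    case 5
    then show ?thesis
      by - (rule ex_forward[OF only_A5_fails], simp add: skew_axiom_def)
  qed
qed

end
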